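(* Let $(V;\rho)$ be a representation of a $3$-Lie algebra $(\mathfrak g,[\cdot,\cdot,\cdot]_{\mathfrak g})$. Then the Maurer-Cartan elements of the Lie $3$-algebra $(C^*(V,\mathfrak g),\{\cdot,\cdot,\cdot\})$ are precisely the embedding tensors on the $3$-Lie algebra $(\mathfrak g,[\cdot,\cdot,\cdot]_{\mathfrak g})$ with respect to the representation $(V;\rho)$.
   Context: All vector spaces are over an algebraically closed field $\mathbb K$ of characteristic $0$. A $3$-Lie algebra is a vector space $\mathfrak g$ with a skew-symmetric trilinear bracket $[\cdot,\cdot,\cdot]_{\mathfrak g}$ such that $[x_1,x_2,[x_3,x_4,x_5]_{\mathfrak g}]_{\mathfrak g}=[[x_1,x_2,x_3]_{\mathfrak g},x_4,x_5]_{\mathfrak g}+[x_3,[x_1,x_2,x_4]_{\mathfrak g},x_5]_{\mathfrak g}+[x_3,x_4,[x_1,x_2,x_5]_{\mathfrak g}]_{\mathfrak g}$ for all $x_i\in\mathfrak g$. A representation of $\mathfrak g$ on a vector space $V$ is a linear map $\rho:\wedge^2\mathfrak g\to\mathfrak{gl}(V)$ such that for all $x_i\in\mathfrak g$: $\rho(x_1,x_2)\rho(x_3,x_4)=\rho([x_1,x_2,x_3]_{\mathfrak g},x_4)+\rho(x_3,[x_1,x_2,x_4]_{\mathfrak g})+\rho(x_3,x_4)\rho(x_1,x_2)$ and $\rho(x_1,[x_2,x_3,x_4]_{\mathfrak g})=\rho(x_3,x_4)\rho(x_1,x_2)-\rho(x_2,x_4)\rho(x_1,x_3)+\rho(x_2,x_3)\rho(x_1,x_4)$.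 An embedding tensor on $\mathfrak g$ with respect to $(V;\rho)$ is a linear map $T:V\to\mathfrak g$ with $[Tu,Tv,Tw]_{\mathfrak g}=T(\rho(Tu,Tv)w)$ for all $u,v,w\in V$. Graded Lie algebra $C^*(W,W)$. For a vector space $W$, $C^n(W,W)=\mathrm{Hom}((\otimes^2W)^{\otimes n}\otimes W,W)$ has degree $n\ge0$ and $C^*(W,W)=\bigoplus_{n\ge0}C^n(W,W)$. For $P\in C^p(W,W)$, $Q\in C^q(W,W)$, $[P,Q]_{\mathsf{3Leib}}=P\circ Q-(-1)^{pq}Q\circ P$, where for $\mathfrak X_i=x_i\otimes y_i\in\otimes^2W$ and $x\in W$, $(P\circ Q)(\mathfrak X_1,\dots,\mathfrak X_{p+q},x)$ $=\sum_{k=1}^p(-1)^{(k-1)q}\sum_{\sigma\in S(k-1,q)}(-1)^\sigma P\big(\mathfrak X_{\sigma(1)},\dots,\mathfrak X_{\sigma(k-1)},Q(\mathfrak X_{\sigma(k)},\dots,\mathfrak X_{\sigma(k+q-1)},x_{k+q})\otimes y_{k+q},\mathfrak X_{k+q+1},\dots,\mathfrak X_{p+q},x\big)$ $+\sum_{k=1}^p(-1)^{(k-1)q}\sum_{\sigma\in S(k-1,q)}(-1)^\sigma P\big(\mathfrak X_{\sigma(1)},\dots,\mathfrak X_{\sigma(k-1)},x_{k+q}\otimes Q(\mathfrak X_{\sigma(k)},\dots,\mathfrak X_{\sigma(k+q-1)},y_{k+q}),\mathfrak X_{k+q+1},\dots,\mathfrak X_{p+q},x\big)$ $+\sum_{\sigma\in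 S(p,q)}(-1)^{pq}(-1)^\sigma P\big(\mathfrak X_{\sigma(1)},\dots,\mathfrak X_{\sigma(p)},Q(\mathfrak X_{\sigma(p+1)},\dots,\mathfrak X_{\sigma(p+q)},x)\big)$, with $S(i,j)$ the set of $(i,j)$-shuffles and $(-1)^\sigma$ the sign of $\sigma$. Lie $3$-algebra $C^*(V,\mathfrak g)$. Let $\mu$ denote $[\cdot,\cdot,\cdot]_{\mathfrak g}$ and let $\mu\boxplus\rho\in C^1(\mathfrak g\oplus V,\mathfrak g\oplus V)$ be $(\mu\boxplus\rho)(x+u,y+v,z+w)=[x,y,z]_{\mathfrak g}+\rho(x,y)w$. Let $C^n(V,\mathfrak g)=\mathrm{Hom}((\otimes^2V)^{\otimes n}\otimes V,\mathfrak g)$ (degree $n$), $C^*(V,\mathfrak g)=\bigoplus_{n\ge0}C^n(V,\mathfrak g)$, regarded as a subspace of $C^*(\mathfrak g\oplus V,\mathfrak g\oplus V)$ by precomposing every argument with the projection $\mathfrak g\oplus V\to V$ and postcomposing with the inclusion of $\mathfrak g$. The trilinear degree-$1$ bracket $\{P,Q,R\}=[[[\mu\boxplus\rho,P]_{\mathsf{3Leib}},Q]_{\mathsf{3Leib}},R]_{\mathsf{3Leib}}$ makes $C^*(V,\mathfrak g)$ a Lie $3$-algebra (a graded symmetric trilinear bracket of degree $1$ with $\sum_{\sigma\in\mathbb S_5}\varepsilon(\sigma)\{\{x_{\sigma(1)},x_{\sigma(2)},x_{\sigma(3)}\},x_{\sigma(4)},x_{\sigma(5)}\}=0$, $\varepsilon(\sigma)$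 the Koszul sign). A Maurer-Cartan element of a Lie $3$-algebra is an element $\alpha$ of degree $0$ with $\frac1{3!}\{\alpha,\alpha,\alpha\}=0$; for $C^*(V,\mathfrak g)$ the degree $0$ part is $\mathrm{Hom}(V,\mathfrak g)$. *)

theory Defs
  imports
    "HOL-Analysis.Product_Vector"
    "HOL-Combinatorics.Permutations"
    "HOL-Computational_Algebra.Polynomial"
    "HOL-Library.Function_Algebras"
begin

locale three_lie_algebra = vector_space sg
  for sg :: "'k::{alg_closed_field, field_char_0} \<Rightarrow> 'g::ab_group_add \<Rightarrow> 'g" +
  fixes br :: "'g \<Rightarrow> 'g \<Rightarrow> 'g \<Rightarrow> 'g"
  assumes br_linear_1: "Vector_Spaces.linear sg sg (\<lambda>x. br x y z)"
    and br_linear_2: "Vector_Spaces.linear sg sg (\<lambda>y. br x y z)"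
    and br_linear_3: "Vector_Spaces.linear sg sg (\<lambda>z. br x y z)"
    and br_skew_12: "br y x z = - br x y z"
    and br_skew_23: "br x z y = - br x y z"
    and fundamental_identity:
      "br x1 x2 (br x3 x4 x5) =
         br (br x1 x2 x3) x4 x5 + br x3 (br x1 x2 x4) x5 + br x3 x4 (br x1 x2 x5)"

text \<open>A linear map from the second exterior power of \<open>g\<close> to \<open>gl(V)\<close> is given as an alternating
  bilinear map \<open>g \<times> g \<rightarrow> gl(V)\<close>, with \<open>\<rho> x y w\<close> standing for \<open>\<rho>(x,y)w\<close>.\<close>

locale three_lie_representation = three_lie_algebra sg br + V: vector_space sv
  for sg :: "'k::{alg_closed_field, field_char_0} \<Rightarrow> 'g::ab_group_add \<Rightarrow> 'g"
    and br :: "'g \<Rightarrow> 'g \<Rightarrow> 'g \<Rightarrow> 'g"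
    and sv :: "'k \<Rightarrow> 'v::ab_group_add \<Rightarrow> 'v" +
  fixes \<rho> :: "'g \<Rightarrow> 'g \<Rightarrow> 'v \<Rightarrow> 'v"
  assumes rho_endo: "Vector_Spaces.linear sv sv (\<rho> x y)"
    and rho_linear_1: "Vector_Spaces.linear sg sv (\<lambda>x. \<rho> x y w)"
    and rho_linear_2: "Vector_Spaces.linear sg sv (\<lambda>y. \<rho> x y w)"
    and rho_alternating: "\<rho> x x w = 0"
    and rho_rho:
      "\<rho> x1 x2 (\<rho> x3 x4 w) =
         \<rho> (br x1 x2 x3) x4 w + \<rho> x3 (br x1 x2 x4) w + \<rho> x3 x4 (\<rho> x1 x2 w)"
    and rho_br:
      "\<rho> x1 (br x2 x3 x4) w =
         \<rho> x3 x4 (\<rho> x1 x2 w) - \<rho> x2 x4 (\<rho> x1 x3 w) + \<rho> x2 x3 (\<rho> x1 x4 w)"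

definition embedding_tensor ::
  "('k::field \<Rightarrow> 'g::ab_group_add \<Rightarrow> 'g) \<Rightarrow> ('g \<Rightarrow> 'g \<Rightarrow> 'g \<Rightarrow> 'g) \<Rightarrow>
   ('k \<Rightarrow> 'v::ab_group_add \<Rightarrow> 'v) \<Rightarrow> ('g \<Rightarrow> 'g \<Rightarrow> 'v \<Rightarrow> 'v) \<Rightarrow> ('v \<Rightarrow> 'g) \<Rightarrow> bool"
  where "embedding_tensor sg br sv \<rho> T \<longleftrightarrow>
    Vector_Spaces.linear sv sg T \<and>
    (\<forall>u v w. br (T u) (T v) (T w) = T (\<rho> (T u) (T v) w))"

text \<open>Elements of \<open>Hom((W \<otimes> W)\<^sup>\<otimes>\<^sup>n \<otimes> W, U)\<close> are multilinear maps in \<open>2n + 1\<close> arguments.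
  They are evaluated on a list \<open>[(x\<^sub>1,y\<^sub>1), \<dots>, (x\<^sub>n,y\<^sub>n)]\<close> of pairs, a pair standing for the
  decomposable tensor \<open>x\<^sub>i \<otimes> y\<^sub>i\<close>, and a last argument. An element of the direct sum over all \<open>n\<close> is a
  single function on lists of all lengths, whose restriction to the lists of length \<open>n\<close> is its
  component of degree \<open>n\<close>.\<close>

type_synonym ('w, 'u) cochain = "('w \<times> 'w) list \<Rightarrow> 'w \<Rightarrow> 'u"

text \<open>The homogeneous cochains of degree \<open>n\<close>.\<close>

definition cochains ::
  "('k::field \<Rightarrow> 'w::ab_group_add \<Rightarrow> 'w) \<Rightarrow> ('k \<Rightarrow> 'u::ab_group_add \<Rightarrow> 'u) \<Rightarrow> nat \<Rightarrow>
   ('w, 'u) cochain set"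
  where "cochains sw su n =
    {P. (\<forall>Xs z. length Xs \<noteq> n \<longrightarrow> P Xs z = 0) \<and>
        (\<forall>Xs. length Xs = n \<longrightarrow> Vector_Spaces.linear sw su (P Xs)) \<and>
        (\<forall>Xs z i x y. length Xs = n \<longrightarrow> i < n \<longrightarrow>
           Vector_Spaces.linear sw su (\<lambda>x. P (Xs[i := (x, y)]) z) \<and>
           Vector_Spaces.linear sw su (\<lambda>y. P (Xs[i := (x, y)]) z))}"

definition cochain_scale :: "('k \<Rightarrow> 'u \<Rightarrow> 'u) \<Rightarrow> 'k \<Rightarrow> ('w, 'u) cochain \<Rightarrow> ('w, 'u) cochain"
  where "cochain_scale su c P = (\<lambda>Xs z. su c (P Xs z))"

definition shuffle_perms :: "nat \<Rightarrow> nat \<Rightarrow> (nat \<Rightarrow> nat) set"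
  where "shuffle_perms i j =
    {\<sigma>. \<sigma> permutes {1..i + j} \<and> strict_mono_on {1..i} \<sigma> \<and> strict_mono_on {i + 1..i + j} \<sigma>}"

text \<open>The product \<open>P \<circ> Q\<close> of the degree \<open>p\<close> component of \<open>P\<close> and the degree \<open>q\<close> component of \<open>Q\<close>,
  meaningful on lists of length \<open>p + q\<close>. List positions count from \<open>0\<close>, the shuffles act on
  \<open>{1, 2, \<dots>}\<close>.\<close>

definition circ ::
  "('k::field \<Rightarrow> 'w::ab_group_add \<Rightarrow> 'w) \<Rightarrow> nat \<Rightarrow> nat \<Rightarrow> ('w, 'w) cochain \<Rightarrow> ('w, 'w) cochain \<Rightarrow>
   ('w, 'w) cochain"
  where "circ s p q P Q Xs z =
    (let X = (\<lambda>i. Xs ! (i - 1)); x = (\<lambda>i. fst (X i)); y = (\<lambda>i. snd (X i)) in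
      (\<Sum>k = 1..p. s ((-1) ^ ((k - 1) * q)) (\<Sum>\<sigma>\<in>shuffle_perms (k - 1) q. s (of_int (sign \<sigma>))
         (P (map (\<lambda>i. X (\<sigma> i)) [1..<k] @
             [(Q (map (\<lambda>i. X (\<sigma> i)) [k..<k + q]) (x (k + q)), y (k + q))] @
             map X [k + q + 1..<p + q + 1]) z)))
    + (\<Sum>k = 1..p. s ((-1) ^ ((k - 1) * q)) (\<Sum>\<sigma>\<in>shuffle_perms (k - 1) q. s (of_int (sign \<sigma>))
         (P (map (\<lambda>i. X (\<sigma> i)) [1..<k] @
             [(x (k + q), Q (map (\<lambda>i. X (\<sigma> i)) [k..<k + q]) (y (k + q)))] @
             map X [k + q + 1..<p + q + 1]) z)))
    + (\<Sum>\<sigma>\<in>shuffle_perms p q. s ((-1) ^ (p * q)) (s (of_int (sign \<sigma>))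
         (P (map (\<lambda>i. X (\<sigma> i)) [1..<p + 1])
            (Q (map (\<lambda>i. X (\<sigma> i)) [p + 1..<p + q + 1]) z)))))"

text \<open>The bracket of two elements of the direct sum: its degree \<open>n\<close> component collects the brackets
  of the components of degrees \<open>p\<close> and \<open>q\<close> with \<open>p + q = n\<close>.\<close>

definition bracket_3Leib ::
  "('k::field \<Rightarrow> 'w::ab_group_add \<Rightarrow> 'w) \<Rightarrow> ('w, 'w) cochain \<Rightarrow> ('w, 'w) cochain \<Rightarrow> ('w, 'w) cochain"
  where "bracket_3Leib s P Q Xs z =
    (\<Sum>(p, q)\<in>{(p, q). p + q = length Xs}.
       circ s p q P Q Xs z - s ((-1) ^ (p * q)) (circ s q p Q P Xs z))"

definition mu_rho ::
  "('g::ab_group_add \<Rightarrow> 'g \<Rightarrow> 'g \<Rightarrow> 'g) \<Rightarrow> ('g \<Rightarrow> 'g \<Rightarrow> 'v::ab_group_add \<Rightarrow> 'v) \<Rightarrow>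
   ('g \<times> 'v, 'g \<times> 'v) cochain"
  where "mu_rho br \<rho> Xs zw =
    (case Xs of
       [((x, u), (y, v))] \<Rightarrow> (br x y (fst zw), \<rho> x y (snd zw))
     | _ \<Rightarrow> 0)"

text \<open>\<open>g \<oplus> V\<close> is the product type with the scalar multiplication \<^const>\<open>module_prod.scale\<close>. Cochains
  on \<open>V\<close> with values in \<open>g\<close> become cochains on \<open>g \<oplus> V\<close> via the projection onto \<open>V\<close> and the inclusion
  of \<open>g\<close>.\<close>

definition extend_cochain ::
  "('v, 'g::ab_group_add) cochain \<Rightarrow> ('g \<times> 'v::ab_group_add, 'g \<times> 'v) cochain"
  where "extend_cochain P Xs z = (P (map (map_prod snd snd) Xs) (snd z), 0)"

text \<open>The homogeneous component of degree \<open>n\<close> of \<open>C\<^sup>*(V,g)\<close>, as a subspace of the cochains on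
  \<open>g \<oplus> V\<close>.\<close>

definition CVg ::
  "('k::field \<Rightarrow> 'g::ab_group_add \<Rightarrow> 'g) \<Rightarrow> ('k \<Rightarrow> 'v::ab_group_add \<Rightarrow> 'v) \<Rightarrow> nat \<Rightarrow>
   ('g \<times> 'v, 'g \<times> 'v) cochain set"
  where "CVg sg sv n = extend_cochain ` cochains sv sg n"

definition bracket3 ::
  "('k::field \<Rightarrow> 'g::ab_group_add \<Rightarrow> 'g) \<Rightarrow> ('g \<Rightarrow> 'g \<Rightarrow> 'g \<Rightarrow> 'g) \<Rightarrow>
   ('k \<Rightarrow> 'v::ab_group_add \<Rightarrow> 'v) \<Rightarrow> ('g \<Rightarrow> 'g \<Rightarrow> 'v \<Rightarrow> 'v) \<Rightarrow>
   ('g \<times> 'v, 'g \<times> 'v) cochain \<Rightarrow> ('g \<times> 'v, 'g \<times> 'v) cochain \<Rightarrow> ('g \<times> 'v, 'g \<times> 'v) cochain \<Rightarrow>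
   ('g \<times> 'v, 'g \<times> 'v) cochain"
  where "bracket3 sg br sv \<rho> P Q R =
    (let B = bracket_3Leib (module_prod.scale sg sv) in B (B (B (mu_rho br \<rho>) P) Q) R)"

text \<open>The Maurer-Cartan elements of a Lie 3-algebra with scalar multiplication \<open>s\<close>, homogeneous
  components \<open>L n\<close> and trilinear bracket \<open>l3\<close>; only these data enter.\<close>

definition maurer_cartan ::
  "('k::field_char_0 \<Rightarrow> 'a::zero \<Rightarrow> 'a) \<Rightarrow> (nat \<Rightarrow> 'a set) \<Rightarrow> ('a \<Rightarrow> 'a \<Rightarrow> 'a \<Rightarrow> 'a) \<Rightarrow> 'a set"
  where "maurer_cartan s L l3 = {\<alpha> \<in> L 0. s (1 / fact 3) (l3 \<alpha> \<alpha> \<alpha>) = 0}"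

text \<open>The identification of \<open>Hom(V,g)\<close> with the degree \<open>0\<close> component of \<open>C\<^sup>*(V,g)\<close>.\<close>

definition hom_cochain :: "('v \<Rightarrow> 'g::zero) \<Rightarrow> ('v, 'g) cochain"
  where "hom_cochain T Xs u = (if Xs = [] then T u else 0)"

lemma cochains_0: "cochains sv sg 0 = hom_cochain ` {T. Vector_Spaces.linear sv sg T}"
proof (intro subset_antisym subsetI)
  fix P
  assume P: "P \<in> cochains sv sg 0"
  have "P = hom_cochain (P [])"
  proof (intro ext)
    fix Xs u
    show "P Xs u = hom_cochain (P []) Xs u"
      using P by (cases "Xs = []") (simp_all add: cochains_def hom_cochain_def)
  qed
  moreover have "Vector_Spaces.linear sv sg (P [])"
    using P by (simp add: cochains_def)
  ultimately show "P \<in> hom_cochain ` {T. Vector_Spaces.linear sv sg T}"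
    by blast
next
  fix P
  assume "P \<in> hom_cochain ` {T. Vector_Spaces.linear sv sg T}"
  then obtain T where T: "Vector_Spaces.linear sv sg T" and P: "P = hom_cochain T"
    by blast
  have "P [] = T"
    by (rule ext) (simp add: P hom_cochain_def)
  moreover have "P Xs z = 0" if "length Xs \<noteq> 0" for Xs z
    using that by (simp add: P hom_cochain_def)
  ultimately show "P \<in> cochains sv sg 0"
    using T by (simp add: cochains_def)
qed

lemma inj_extend_hom_cochain:
  "inj (\<lambda>T :: 'v::ab_group_add \<Rightarrow> 'g::ab_group_add. extend_cochain (hom_cochain T))"
proof (rule injI)
  fix S T :: "'v \<Rightarrow> 'g"
  assume "extend_cochain (hom_cochain S) = extend_cochain (hom_cochain T)"
  then have "extend_cochain (hom_cochain S) [] (0, u) = extend_cochain (hom_cochain T) [] (0, u)" for u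
    by simp
  then show "S = T"
    by (auto simp: extend_cochain_def hom_cochain_def)
qed

end

theory Submission
  imports Defs
begin

text \<open>
  A linear map \<open>T : V \<rightarrow> g\<close> becomes the endomorphism \<open>A (x + u) = T u\<close> of \<open>W = g \<oplus> V\<close>, a cochain of
  degree \<open>0\<close>. The bracket with \<open>A\<close> preserves degrees, so on ternary operations \<open>m\<close> it is the usual
  infinitesimal action of an endomorphism,
  \<open>(m\<cdot>A)(x,y,z) = m(Ax,y,z) + m(x,Ay,z) + m(x,y,Az) - A m(x,y,z)\<close>
  (lemma \<open>bracket_ternary_hom\<close>). Three iterations place three copies of \<open>A\<close> on the three inputs and
  on the output. Since \<open>A \<circ> A = 0\<close>, the only surviving terms have at most one copy at each place, and
  each of them arises in \<open>3! = 6\<close> orders (lemma \<open>hom_action_cubed\<close>). For \<open>m = \<mu> \<boxplus> \<rho>\<close> the operator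
  \<open>A\<close> sees only the \<open>V\<close>-component of its argument, which is linear in the \<open>V\<close>-component of the
  third input of \<open>m\<close>. Since \<open>A\<close> takes values in \<open>g\<close>, this input has none in \<open>A m(Ax,y,Az)\<close> and
  \<open>A m(x,Ay,Az)\<close>, so these two terms vanish too. What remains of
  \<open>{A,A,A}\<close> on \<open>(x + u, y + v, z + w)\<close> is \<open>6 ([Tu,Tv,Tw] - T(\<rho>(Tu,Tv)w))\<close>. Characteristic \<open>0\<close>
  allows the division by \<open>3!\<close>, and its vanishing is the embedding tensor identity.
\<close>

text \<open>Ternary operations placed in degree \<open>1\<close>, in the same way as \<^const>\<open>hom_cochain\<close> places unary
  ones in degree \<open>0\<close>.\<close>

definition ternary_cochain :: "('w \<Rightarrow> 'w \<Rightarrow> 'w \<Rightarrow> 'u::zero) \<Rightarrow> ('w, 'u) cochain"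
  where "ternary_cochain m Xs z = (case Xs of [(x, y)] \<Rightarrow> m x y z | _ \<Rightarrow> 0)"

lemma ternary_cochain_single [simp]: "ternary_cochain m [X] z = m (fst X) (snd X) z"
  by (simp add: ternary_cochain_def split: prod.split)

lemma ternary_cochain_other: "length Xs \<noteq> 1 \<Longrightarrow> ternary_cochain m Xs z = 0"
  by (auto simp: ternary_cochain_def split: list.split)

definition hom_action ::
  "('w::ab_group_add \<Rightarrow> 'w) \<Rightarrow> ('w \<Rightarrow> 'w \<Rightarrow> 'w \<Rightarrow> 'w) \<Rightarrow> 'w \<Rightarrow> 'w \<Rightarrow> 'w \<Rightarrow> 'w"
  where "hom_action A m x y z = m (A x) y z + m x (A y) z + m x y (A z) - A (m x y z)"

text \<open>A cochain evaluated outside its degree gives \<open>0\<close>, and in a product this \<open>0\<close> enters the other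
  factor as an argument. This is the part of multilinearity that makes such terms disappear.\<close>

definition vanishing_at_0 :: "('w::zero \<Rightarrow> 'w \<Rightarrow> 'w \<Rightarrow> 'u::zero) \<Rightarrow> bool"
  where "vanishing_at_0 m \<longleftrightarrow> (\<forall>x y. m 0 x y = 0 \<and> m x 0 y = 0 \<and> m x y 0 = 0)"

lemma vanishing_at_0_hom_action:
  "A 0 = 0 \<Longrightarrow> vanishing_at_0 m \<Longrightarrow> vanishing_at_0 (hom_action A m)"
  by (simp add: vanishing_at_0_def hom_action_def)

lemma shuffle_perms_0_0: "shuffle_perms 0 0 = {id}"
  by (auto simp: shuffle_perms_def strict_mono_on_def)

lemma shuffle_perms_0_1: "shuffle_perms 0 (Suc 0) = {id}"
  by (auto simp: shuffle_perms_def strict_mono_on_def)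

lemma shuffle_perms_1_0: "shuffle_perms (Suc 0) 0 = {id}"
  by (auto simp: shuffle_perms_def strict_mono_on_def)

text \<open>The operation \<open>m\<close> lives in degree \<open>1\<close> and \<open>A\<close> in degree \<open>0\<close>, so no other pair of degrees
  contributes to a product of the two, in either order. This is why the bracket of \<open>m\<close> with \<open>A\<close>
  stays in degree \<open>1\<close>.\<close>

lemma circ_ternary_hom_eq_0:
  assumes "module s" and m: "vanishing_at_0 m" and pq: "(p, q) \<noteq> (1, 0)"
  shows "circ s p q (ternary_cochain m) (hom_cochain A) Xs z = 0"
proof -
  interpret module s by fact
  show ?thesis
  proof (cases "p = 1")
    case True
    then have "q \<noteq> 0" using pq by simp
    then show ?thesis
      using True m by (simp add: circ_def hom_cochain_def vanishing_at_0_def)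
  next
    case False
    then show ?thesis
      by (simp add: circ_def ternary_cochain_other)
  qed
qed

lemma circ_hom_ternary_eq_0:
  assumes "module s" and A: "A 0 = 0" and pq: "(p, q) \<noteq> (1, 0)"
  shows "circ s q p (hom_cochain A) (ternary_cochain m) Xs z = 0"
proof -
  interpret module s by fact
  show ?thesis
  proof (cases "q = 0")
    case True
    then have "p \<noteq> 1" using pq by simp
    then show ?thesis
      using True A by (simp add: circ_def hom_cochain_def ternary_cochain_other)
  next
    case False
    then show ?thesis
      by (simp add: circ_def hom_cochain_def)
  qed
qed

lemma circ_ternary_hom_1_0:
  assumes "module s"
  shows "circ s 1 0 (ternary_cochain m) (hom_cochain A) [(x, y)] z
    = m (A x) y z + m x (A y) z + m x y (A z)"
proof -
  interpret module s by fact
  show ?thesis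
    by (simp add: circ_def hom_cochain_def shuffle_perms_0_0 shuffle_perms_1_0)
qed

lemma circ_hom_ternary_0_1:
  assumes "module s"
  shows "circ s 0 1 (hom_cochain A) (ternary_cochain m) [(x, y)] z = A (m x y z)"
proof -
  interpret module s by fact
  show ?thesis
    by (simp add: circ_def hom_cochain_def shuffle_perms_0_1)
qed

lemma bracket_ternary_hom:
  assumes s: "module s" and A: "A 0 = 0" and m: "vanishing_at_0 m"
  shows "bracket_3Leib s (ternary_cochain m) (hom_cochain A) = ternary_cochain (hom_action A m)"
proof (intro ext)
  fix Xs z
  interpret module s by fact
  let ?term = "\<lambda>p q. circ s p q (ternary_cochain m) (hom_cochain A) Xs z
    - s ((-1) ^ (p * q)) (circ s q p (hom_cochain A) (ternary_cochain m) Xs z)"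
  have zero: "?term p q = 0" if "(p, q) \<noteq> (1, 0)" for p q
    using that by (simp add: circ_ternary_hom_eq_0[OF s m] circ_hom_ternary_eq_0[of s A, OF s A])
  show "bracket_3Leib s (ternary_cochain m) (hom_cochain A) Xs z
      = ternary_cochain (hom_action A m) Xs z"
  proof (cases "length Xs = 1")
    case True
    then obtain x y where Xs: "Xs = [(x, y)]"
      by (cases Xs) auto
    have "{(p, q). p + q = length Xs} = {(1, 0), (0, 1)}"
      using True by auto
    then have "bracket_3Leib s (ternary_cochain m) (hom_cochain A) Xs z = ?term 1 0"
      using zero[of 0 1] by (simp add: bracket_3Leib_def)
    also have "\<dots> = hom_action A m x y z"
      using circ_ternary_hom_1_0[OF s, of m A x y z] circ_hom_ternary_0_1[OF s, of A m x y z]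
      by (simp add: Xs hom_action_def)
    finally show ?thesis by (simp add: Xs)
  next
    case False
    have "bracket_3Leib s (ternary_cochain m) (hom_cochain A) Xs z = 0"
      unfolding bracket_3Leib_def
    proof (rule sum.neutral, clarify)
      fix p q assume "p + q = length Xs"
      then show "?term p q = 0" using False by (intro zero) auto
    qed
    then show ?thesis using False by (simp add: ternary_cochain_other)
  qed
qed

text \<open>The four operators on \<open>m\<close> "insert \<open>A\<close> at one of the three inputs" and "minus \<open>A\<close> applied to
  the output" commute and square to zero, so the cube of their sum is \<open>3!\<close> times the sum of the
  products of three different ones.\<close>

lemma hom_action_cubed:
  assumes A: "additive A" and sq: "\<And>x. A (A x) = 0" and m: "vanishing_at_0 m"
  shows "hom_action A (hom_action A (hom_action A m)) x y z =
    (let d = m (A x) (A y) (A z) - A (m (A x) (A y) z) - A (m (A x) y (A z)) - A (m x (A y) (A z))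
     in d + d + d + d + d + d)"
proof -
  interpret additive A by fact
  show ?thesis
    using m by (simp add: hom_action_def Let_def add diff sq zero vanishing_at_0_def)
qed

lemma extend_hom_cochain:
  "extend_cochain (hom_cochain T) = hom_cochain (\<lambda>z. (T (snd z), 0))"
  by (auto simp: fun_eq_iff extend_cochain_def hom_cochain_def zero_prod_def)

lemma mu_rho_eq_ternary:
  "mu_rho br \<rho> = ternary_cochain (\<lambda>a b c. (br (fst a) (fst b) (fst c), \<rho> (fst a) (fst b) (snd c)))"
  by (auto simp: fun_eq_iff mu_rho_def ternary_cochain_def split: list.split)

lemma linear_at_0: "Vector_Spaces.linear s t f \<Longrightarrow> f 0 = 0"
  unfolding Vector_Spaces.linear_def by (auto dest: module_hom.zero)

context three_lie_representation
begin

sublocale W: module_prod sg sv ..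

lemma br_rho_at_0:
  "br 0 y z = 0" "br x 0 z = 0" "br x y 0 = 0" "\<rho> 0 y w = 0" "\<rho> x 0 w = 0" "\<rho> x y 0 = 0"
  using linear_at_0[OF br_linear_1] linear_at_0[OF br_linear_2] linear_at_0[OF br_linear_3]
    linear_at_0[OF rho_linear_1] linear_at_0[OF rho_linear_2] linear_at_0[OF rho_endo]
  by auto

lemma bracket3_hom:
  assumes T: "Vector_Spaces.linear sv sg T"
  defines "\<alpha> \<equiv> extend_cochain (hom_cochain T)"
  shows "bracket3 sg br sv \<rho> \<alpha> \<alpha> \<alpha> = ternary_cochain (\<lambda>a b c.
    W.scale 6 (br (T (snd a)) (T (snd b)) (T (snd c)) - T (\<rho> (T (snd a)) (T (snd b)) (snd c)), 0))"
proof -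
  interpret T: Vector_Spaces.linear sv sg T by fact
  let ?A = "\<lambda>z :: 'g \<times> 'v. (T (snd z), 0 :: 'v)"
  let ?m = "\<lambda>a b c. (br (fst a) (fst b) (fst c), \<rho> (fst a) (fst b) (snd c))"
  have s: "module W.scale" ..
  have A0: "?A 0 = 0"
    by (simp add: T.zero zero_prod_def)
  have A: "additive ?A"
    by (simp add: additive_def T.add)
  have m: "vanishing_at_0 ?m"
    by (simp add: vanishing_at_0_def br_rho_at_0 zero_prod_def)
  have six: "d + d + d + d + d + d = W.scale 6 d" for d
  proof -
    have "W.scale 6 d = W.scale (1 + 1 + 1 + 1 + 1 + 1) d"
      by simp
    also have "\<dots> = d + d + d + d + d + d"
      by (simp only: W.p.scale_left_distrib W.p.scale_one)
    finally show ?thesis by simp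
  qed
  have "bracket3 sg br sv \<rho> \<alpha> \<alpha> \<alpha>
      = ternary_cochain (hom_action ?A (hom_action ?A (hom_action ?A ?m)))"
    unfolding bracket3_def Let_def \<alpha>_def extend_hom_cochain mu_rho_eq_ternary
    by (simp add: bracket_ternary_hom[of W.scale ?A, OF s A0] vanishing_at_0_hom_action[of ?A, OF A0] m)
  also have "hom_action ?A (hom_action ?A (hom_action ?A ?m)) = (\<lambda>a b c.
    W.scale 6 (br (T (snd a)) (T (snd b)) (T (snd c)) - T (\<rho> (T (snd a)) (T (snd b)) (snd c)), 0))"
    by (intro ext, subst hom_action_cubed[OF A _ m])
      (simp_all add: T.zero br_rho_at_0 zero_prod_def six Let_def del: add_Pair)
  finally show ?thesis .
qed

lemma maurer_cartan_equation_iff: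
  assumes T: "Vector_Spaces.linear sv sg T"
  defines "\<alpha> \<equiv> extend_cochain (hom_cochain T)"
  shows "cochain_scale W.scale (1 / fact 3) (bracket3 sg br sv \<rho> \<alpha> \<alpha> \<alpha>) = 0
    \<longleftrightarrow> embedding_tensor sg br sv \<rho> T"
proof -
  have fact3: "6 / fact 3 = (1 :: 'k)"
    by (simp add: fact_numeral)
  have "cochain_scale W.scale (1 / fact 3) (bracket3 sg br sv \<rho> \<alpha> \<alpha> \<alpha>) = ternary_cochain (\<lambda>a b c.
    (br (T (snd a)) (T (snd b)) (T (snd c)) - T (\<rho> (T (snd a)) (T (snd b)) (snd c)), 0))"
    (is "?lhs = ternary_cochain ?d")
  proof (intro ext)
    fix Xs z
    show "?lhs Xs z = ternary_cochain ?d Xs z"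
      unfolding \<alpha>_def bracket3_hom[OF T] cochain_scale_def
      by (cases "length Xs = 1")
        (auto simp: length_Suc_conv ternary_cochain_other fact3)
  qed
  moreover have "ternary_cochain ?d = 0 \<longleftrightarrow>
    (\<forall>u v w. br (T u) (T v) (T w) = T (\<rho> (T u) (T v) w))"
  proof
    assume *: "ternary_cochain ?d = 0"
    show "\<forall>u v w. br (T u) (T v) (T w) = T (\<rho> (T u) (T v) w)"
    proof (intro allI)
      fix u v w
      have "ternary_cochain ?d [((0, u), (0, v))] (0, w) = 0"
        using * by simp
      then show "br (T u) (T v) (T w) = T (\<rho> (T u) (T v) w)"
        by (simp add: zero_prod_def)
    qed
  next
    assume "\<forall>u v w. br (T u) (T v) (T w) = T (\<rho> (T u) (T v) w)"
    then show "ternary_cochain ?d = 0"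
      by (auto simp: fun_eq_iff ternary_cochain_def zero_prod_def split: list.split)
  qed
  ultimately show ?thesis
    using T by (simp add: embedding_tensor_def)
qed

end

theorem theorem3p11:
  fixes sg :: "'k::{alg_closed_field, field_char_0} \<Rightarrow> 'g::ab_group_add \<Rightarrow> 'g"
    and br :: "'g \<Rightarrow> 'g \<Rightarrow> 'g \<Rightarrow> 'g"
    and sv :: "'k \<Rightarrow> 'v::ab_group_add \<Rightarrow> 'v"
    and \<rho> :: "'g \<Rightarrow> 'g \<Rightarrow> 'v \<Rightarrow> 'v"
  assumes "three_lie_representation sg br sv \<rho>"
  shows "maurer_cartan (cochain_scale (module_prod.scale sg sv)) (CVg sg sv) (bracket3 sg br sv \<rho>)
    = (\<lambda>T. extend_cochain (hom_cochain T)) ` {T. embedding_tensor sg br sv \<rho> T}"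
proof -
  interpret three_lie_representation sg br sv \<rho> by fact
  have "embedding_tensor sg br sv \<rho> T \<Longrightarrow> Vector_Spaces.linear sv sg T" for T
    by (simp add: embedding_tensor_def)
  then show ?thesis
    unfolding maurer_cartan_def CVg_def cochains_0
    using maurer_cartan_equation_iff by (auto simp: image_iff)
qed

end
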